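(* Let $G$ be an outerplanar graph with vertex set $V$ and edge set $E$ whose components are each either a copy of $K_2$ or an even cycle graph $C_n$ with $n\neq 4$. Then the main diagonal of the magnitude homology of $G$ is torsion-free, with $\mathrm{rank}\,\mathrm{MH}_{0,0}(G)=|V|$ and $\mathrm{rank}\,\mathrm{MH}_{k,k}(G)=2|E|$ for all $k>0$.
   Context: Graphs are finite, undirected, with no loops and no multiple edges. For a graph $G$, $d(x,y)$ denotes the shortest-path distance (edges have length $1$; $\infty$ if no path). A $k$-path is a tuple $(x_0,\dots,x_k)$ of vertices with $x_i\neq x_{i+1}$ and $d(x_i,x_{i+1})<\infty$; its length is $\sum_i d(x_i,x_{i+1})$. $\mathrm{MC}_{k,\ell}(G)$ is the free abelian group on $k$-paths of length $\ell$, with differential $\partial=\sum_{i=1}^{k-1}(-1)^i\partial_i$, where $\partial_i$ deletes $x_i$ if the resulting tuple is a $(k-1)$-path of the same length $\ell$ and is $0$ otherwise; $\mathrm{MH}_{k,\ell}(G)=H_k(\mathrm{MC}_{*,\ell}(G))$; the main diagonal is $(\mathrm{MH}_{k,k}(G))_{k\ge0}$. Outerplanar graphs and their components: a graph is outerplanar if it can be written as $G=H_1\star H_2\star\cdots\star H_t$, where each $H_s$ is a copy of $K_2$ (a single edge) or a cycle graph $C_n$, and for each $s$ the graph $H_1\star\cdots\star H_s$ is formed from $H_1\star\cdots\star H_{s-1}$ by identifying a vertex or an edge of $H_s$ with a vertex or edge, respectively, on the outer face of $H_1\star\cdots\star H_{s-1}$ (with respect to a crossing-free plane drawing with all vertices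 on the outer face). The subgraphs $H_s$ are called the components of $G$. *)

theory Defs
  imports
    "HOL-Analysis.Analysis"
    "HOL-Algebra.Free_Abelian_Groups"
    "HOL-Library.Extended_Nat"
begin

section \<open>Finite simple graphs\<close>

record 'a ugraph =
  verts :: "'a set"
  edges :: "'a set set"

definition simple_graph :: "'a ugraph \<Rightarrow> bool" where
  "simple_graph G \<longleftrightarrow> finite (verts G) \<and> (\<forall>e\<in>edges G. e \<subseteq> verts G \<and> card e = 2)"

definition graph_union :: "'a ugraph \<Rightarrow> 'a ugraph \<Rightarrow> 'a ugraph" where
  "graph_union G H = \<lparr>verts = verts G \<union> verts H, edges = edges G \<union> edges H\<rparr>"

definition is_K2 :: "'a ugraph \<Rightarrow> bool" where
  "is_K2 H \<longleftrightarrow> (\<exists>u v. u \<noteq> v \<and> H = \<lparr>verts = {u, v}, edges = {{u, v}}\<rparr>)"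

definition is_cycle_graph :: "nat \<Rightarrow> 'a ugraph \<Rightarrow> bool" where
  "is_cycle_graph n H \<longleftrightarrow> n \<ge> 3 \<and>
     (\<exists>f :: nat \<Rightarrow> 'a. inj_on f {..<n} \<and>
        H = \<lparr>verts = f ` {..<n}, edges = (\<lambda>i. {f i, f (Suc i mod n)}) ` {..<n}\<rparr>)"

definition walk_betw :: "'a ugraph \<Rightarrow> 'a \<Rightarrow> 'a list \<Rightarrow> 'a \<Rightarrow> bool" where
  "walk_betw G x xs y \<longleftrightarrow> xs \<noteq> [] \<and> hd xs = x \<and> last xs = y \<and> set xs \<subseteq> verts G \<and>
     successively (\<lambda>u v. {u, v} \<in> edges G) xs"

text \<open>The infimum over the empty set is \<open>\<infinity>\<close>; a walk of minimal length is a path.\<close>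

definition gdist :: "'a ugraph \<Rightarrow> 'a \<Rightarrow> 'a \<Rightarrow> enat" where
  "gdist G x y = (INF xs\<in>{xs. walk_betw G x xs y}. enat (length xs - 1))"


section \<open>Outerplanar graphs and their components\<close>

text \<open>The vertex \<open>v\<close> is drawn as the point \<open>p v\<close>, the edge \<open>e\<close> as the simple arc \<open>\<gamma> e\<close>.\<close>

definition plane_drawing :: "'a ugraph \<Rightarrow> ('a \<Rightarrow> complex) \<Rightarrow> ('a set \<Rightarrow> real \<Rightarrow> complex) \<Rightarrow> bool" where
  "plane_drawing G p \<gamma> \<longleftrightarrow>
     inj_on p (verts G) \<and>
     (\<forall>e\<in>edges G. arc (\<gamma> e) \<and> {pathstart (\<gamma> e), pathfinish (\<gamma> e)} = p ` e \<and>
        path_image (\<gamma> e) \<inter> p ` verts G = p ` e) \<and>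
     (\<forall>e\<in>edges G. \<forall>f\<in>edges G. e \<noteq> f \<longrightarrow>
        path_image (\<gamma> e) \<inter> path_image (\<gamma> f) = p ` (e \<inter> f))"

text \<open>\<^const>\<open>outside\<close> of the drawing is the unbounded component of its complement.\<close>

definition outer_face :: "'a ugraph \<Rightarrow> ('a \<Rightarrow> complex) \<Rightarrow> ('a set \<Rightarrow> real \<Rightarrow> complex) \<Rightarrow> complex set" where
  "outer_face G p \<gamma> = outside (p ` verts G \<union> (\<Union>e\<in>edges G. path_image (\<gamma> e)))"

definition vertex_on_outer_face ::
    "'a ugraph \<Rightarrow> ('a \<Rightarrow> complex) \<Rightarrow> ('a set \<Rightarrow> real \<Rightarrow> complex) \<Rightarrow> 'a \<Rightarrow> bool" where
  "vertex_on_outer_face G p \<gamma> v \<longleftrightarrow> v \<in> verts G \<and> p v \<in> frontier (outer_face G p \<gamma>)"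

definition edge_on_outer_face ::
    "'a ugraph \<Rightarrow> ('a \<Rightarrow> complex) \<Rightarrow> ('a set \<Rightarrow> real \<Rightarrow> complex) \<Rightarrow> 'a set \<Rightarrow> bool" where
  "edge_on_outer_face G p \<gamma> e \<longleftrightarrow> e \<in> edges G \<and> path_image (\<gamma> e) \<subseteq> frontier (outer_face G p \<gamma>)"

definition outerplane_drawing ::
    "'a ugraph \<Rightarrow> ('a \<Rightarrow> complex) \<Rightarrow> ('a set \<Rightarrow> real \<Rightarrow> complex) \<Rightarrow> bool" where
  "outerplane_drawing G p \<gamma> \<longleftrightarrow>
     plane_drawing G p \<gamma> \<and> (\<forall>v\<in>verts G. vertex_on_outer_face G p \<gamma> v)"

text \<open>
  \<open>outerplanar_decomposition G [H\<^sub>1, \<dots>, H\<^sub>t]\<close> says that \<open>G = H\<^sub>1 \<star> \<dots> \<star> H\<^sub>t\<close>, the \<open>H\<^sub>s\<close> being taken as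
  subgraphs of \<open>G\<close>. Identifying a vertex (an edge) of \<open>H\<^sub>s\<close> with one of \<open>H\<^sub>1 \<star> \<dots> \<star> H\<^sub>s\<^sub>-\<^sub>1\<close> is
  expressed by the two subgraphs meeting in exactly that vertex (that edge and its ends).
  A graph is outerplanar iff it has such a decomposition.
\<close>

inductive outerplanar_decomposition :: "'a ugraph \<Rightarrow> 'a ugraph list \<Rightarrow> bool" where
  single:
    "is_K2 H \<or> (\<exists>n. is_cycle_graph n H) \<Longrightarrow> outerplanar_decomposition H [H]"
| glue_vertex:
    "outerplanar_decomposition G Hs \<Longrightarrow> is_K2 H \<or> (\<exists>n. is_cycle_graph n H) \<Longrightarrow>
     outerplane_drawing G p \<gamma> \<Longrightarrow> vertex_on_outer_face G p \<gamma> v \<Longrightarrow>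
     verts G \<inter> verts H = {v} \<Longrightarrow>
     outerplanar_decomposition (graph_union G H) (Hs @ [H])"
| glue_edge:
    "outerplanar_decomposition G Hs \<Longrightarrow> is_K2 H \<or> (\<exists>n. is_cycle_graph n H) \<Longrightarrow>
     outerplane_drawing G p \<gamma> \<Longrightarrow> edge_on_outer_face G p \<gamma> e \<Longrightarrow>
     e \<in> edges H \<Longrightarrow> verts G \<inter> verts H = e \<Longrightarrow>
     outerplanar_decomposition (graph_union G H) (Hs @ [H])"

lemma simple_graph_component:
  assumes "is_K2 H \<or> (\<exists>n. is_cycle_graph n H)"
  shows "simple_graph H"
proof -
  have "card {f i, f (Suc i mod n)} = 2"
    if "n \<ge> 3" "inj_on f {..<n}" "i < n" for f :: "nat \<Rightarrow> 'a" and n i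
  proof -
    have "Suc i mod n \<noteq> i"
      using that by (cases "Suc i = n") auto
    moreover have "Suc i mod n < n"
      using that by simp
    ultimately have "f i \<noteq> f (Suc i mod n)"
      using that by (metis inj_on_eq_iff lessThan_iff)
    then show ?thesis by simp
  qed
  then have cyc: "simple_graph H" if "is_cycle_graph n H" for n
    using that unfolding is_cycle_graph_def simple_graph_def by (elim conjE exE) auto
  have "simple_graph H" if "is_K2 H"
    using that unfolding is_K2_def simple_graph_def by auto
  with cyc assms show ?thesis by blast
qed

lemma simple_graph_union:
  "simple_graph G \<Longrightarrow> simple_graph H \<Longrightarrow> simple_graph (graph_union G H)"
  unfolding simple_graph_def graph_union_def by auto

lemma outerplanar_decomposition_simple_graph:
  "outerplanar_decomposition G Hs \<Longrightarrow> simple_graph G"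
  by (induction rule: outerplanar_decomposition.induct)
    (blast intro: simple_graph_component simple_graph_union)+


section \<open>Magnitude homology\<close>

text \<open>The \<open>k\<close>-paths \<open>(x\<^sub>0, \<dots>, x\<^sub>k)\<close> of length \<open>l\<close>.\<close>

definition kpaths :: "'a ugraph \<Rightarrow> nat \<Rightarrow> nat \<Rightarrow> 'a list set" where
  "kpaths G k l = {xs. length xs = Suc k \<and> set xs \<subseteq> verts G \<and>
     (\<forall>i<k. xs ! i \<noteq> xs ! Suc i \<and> gdist G (xs ! i) (xs ! Suc i) < \<infinity>) \<and>
     (\<Sum>i<k. gdist G (xs ! i) (xs ! Suc i)) = enat l}"

definition MC :: "'a ugraph \<Rightarrow> nat \<Rightarrow> nat \<Rightarrow> ('a list \<Rightarrow>\<^sub>0 int) monoid" where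
  "MC G k l = free_Abelian_group (kpaths G k l)"

definition MC_face :: "'a ugraph \<Rightarrow> nat \<Rightarrow> nat \<Rightarrow> nat \<Rightarrow> 'a list \<Rightarrow> ('a list \<Rightarrow>\<^sub>0 int)" where
  "MC_face G k l i xs =
     (let ys = take i xs @ drop (Suc i) xs
      in if ys \<in> kpaths G (k - 1) l then frag_of ys else 0)"

text \<open>For \<open>k = 0\<close> and \<open>k = 1\<close> the sum is empty and the differential is \<open>0\<close>.\<close>

definition MC_boundary :: "'a ugraph \<Rightarrow> nat \<Rightarrow> nat \<Rightarrow> ('a list \<Rightarrow>\<^sub>0 int) \<Rightarrow> ('a list \<Rightarrow>\<^sub>0 int)" where
  "MC_boundary G k l =
     frag_extend (\<lambda>xs. \<Sum>i\<in>{1..<k}. frag_cmul ((-1) ^ i) (MC_face G k l i xs))"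

definition MC_cycles :: "'a ugraph \<Rightarrow> nat \<Rightarrow> nat \<Rightarrow> ('a list \<Rightarrow>\<^sub>0 int) set" where
  "MC_cycles G k l = {c \<in> carrier (MC G k l). MC_boundary G k l c = 0}"

definition MC_boundaries :: "'a ugraph \<Rightarrow> nat \<Rightarrow> nat \<Rightarrow> ('a list \<Rightarrow>\<^sub>0 int) set" where
  "MC_boundaries G k l = MC_boundary G (Suc k) l ` carrier (MC G (Suc k) l)"

definition MH :: "'a ugraph \<Rightarrow> nat \<Rightarrow> nat \<Rightarrow> ('a list \<Rightarrow>\<^sub>0 int) set monoid" where
  "MH G k l = subgroup_generated (MC G k l) (MC_cycles G k l) Mod MC_boundaries G k l"


section \<open>Torsion and rank of abelian groups\<close>

definition torsion_free :: "('b, 'c) monoid_scheme \<Rightarrow> bool" where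
  "torsion_free A \<longleftrightarrow>
     (\<forall>x\<in>carrier A. \<forall>n::nat. n > 0 \<longrightarrow> x [^]\<^bsub>A\<^esub> n = \<one>\<^bsub>A\<^esub> \<longrightarrow> x = \<one>\<^bsub>A\<^esub>)"

definition int_independent :: "('b, 'c) monoid_scheme \<Rightarrow> 'b set \<Rightarrow> bool" where
  "int_independent A S \<longleftrightarrow> finite S \<and> S \<subseteq> carrier A \<and>
     (\<forall>c :: 'b \<Rightarrow> int. (\<Otimes>\<^bsub>A\<^esub>x\<in>S. x [^]\<^bsub>A\<^esub> c x) = \<one>\<^bsub>A\<^esub> \<longrightarrow> (\<forall>x\<in>S. c x = 0))"

definition ab_rank :: "('b, 'c) monoid_scheme \<Rightarrow> enat" where
  "ab_rank A = (SUP S\<in>{S. int_independent A S}. enat (card S))"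

end

theory Submission imports Defs begin

text \<open>
  Since \<open>k\<close>-paths have length at least \<open>k\<close>, there are no boundaries on the main diagonal, and the chains
  are spanned by walks. Gluing along a vertex or an edge creates no short cycle, so \<open>G\<close> has no cycle of
  length 3 or 4. Hence the \<open>i\<close>-th face of a walk is nonzero exactly if the walk does not
  backtrack at \<open>i\<close>, and a nonzero face determines both the walk and \<open>i\<close>: the cycles are freely
  generated by the walks \<open>u, v, u, v, \<dots>\<close>, of which there are two for each edge when \<open>k > 0\<close>.
\<close>

section \<open>Finitely generated free abelian groups\<close>

text \<open>Gaussian elimination one coordinate at a time, with cross-multiplication in place of
  division so that the coefficients stay integers. It serves as the upper bound for ranks.\<close>

lemma int_linear_dependence:
  fixes v :: "'s \<Rightarrow> 'x \<Rightarrow> int"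
  assumes "finite X" "finite S" "card X < card S"
  obtains c :: "'s \<Rightarrow> int" where "\<exists>s\<in>S. c s \<noteq> 0" "\<forall>x\<in>X. (\<Sum>s\<in>S. c s * v s x) = 0"
proof -
  have "\<exists>c :: 's \<Rightarrow> int. (\<exists>s\<in>S. c s \<noteq> 0) \<and> (\<forall>x\<in>X. (\<Sum>s\<in>S. c s * v s x) = 0)"
    using assms
  proof (induction X arbitrary: S v rule: finite_induct)
    case empty
    then have "S \<noteq> {}" by auto
    then show ?case by (intro exI[of _ "\<lambda>_. 1"]) auto
  next
    case (insert x X)
    show ?case
    proof (cases "\<forall>s\<in>S. v s x = 0")
      case True
      from insert.IH[of S v] insert.prems insert.hyps obtain c
        where "\<exists>s\<in>S. c s \<noteq> 0" "\<forall>y\<in>X. (\<Sum>s\<in>S. c s * v s y) = 0" by auto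
      with True show ?thesis by (intro exI[of _ c]) auto
    next
      case False
      then obtain t where t: "t \<in> S" "v t x \<noteq> 0" by blast
      \<comment> \<open>\<open>t\<close> is the pivot: \<open>w s\<close> is the combination of
        \<open>v s\<close> and \<open>v t\<close> in which the coordinate \<open>x\<close>
        cancels.\<close>
      define w where "w s y = v t x * v s y - v s x * v t y" for s y
      have "card X < card (S - {t})"
        using insert.prems insert.hyps t by auto
      with insert.IH[of "S - {t}" w] insert.prems obtain c
        where c: "\<exists>s\<in>S - {t}. c s \<noteq> 0" "\<forall>y\<in>X. (\<Sum>s\<in>S - {t}. c s * w s y) = 0" by auto
      \<comment> \<open>Expanding \<open>w\<close> in the relation \<open>c\<close> collects all
        multiples of \<open>v t\<close> into one coefficient at \<open>t\<close>.\<close>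
      define d where "d s = (if s = t then - (\<Sum>r\<in>S - {t}. c r * v r x) else v t x * c s)" for s
      have d: "(\<Sum>s\<in>S. d s * v s y) = (\<Sum>s\<in>S - {t}. c s * w s y)" for y
      proof -
        have "(\<Sum>s\<in>S. d s * v s y) = d t * v t y + (\<Sum>s\<in>S - {t}. d s * v s y)"
          using t insert.prems by (simp add: sum.remove)
        also have "(\<Sum>s\<in>S - {t}. d s * v s y) = (\<Sum>s\<in>S - {t}. v t x * c s * v s y)"
          by (intro sum.cong) (auto simp: d_def)
        moreover have "d t = - (\<Sum>r\<in>S - {t}. c r * v r x)"
          by (simp add: d_def)
        ultimately show ?thesis
          by (simp add: w_def sum_subtractf right_diff_distrib sum_distrib_left mult_ac)
      qed
      have "\<exists>s\<in>S. d s \<noteq> 0"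
        using c(1) t by (auto simp: d_def)
      \<comment> \<open>At \<open>x\<close> itself every \<open>w s x\<close> is 0; on
        \<open>X\<close> the relation \<open>c\<close> applies.\<close>
      moreover have "(\<Sum>s\<in>S. d s * v s y) = 0" if "y \<in> insert x X" for y
        using that c(2) unfolding d by (auto simp: w_def algebra_simps)
      ultimately show ?thesis by blast
    qed
  qed
  then show thesis using that by blast
qed

lemma (in group_hom) hom_finprod_int_pow:
  assumes "comm_group G" "comm_group H" "finite S" "S \<subseteq> carrier G"
  shows "h (\<Otimes>\<^bsub>G\<^esub>x\<in>S. x [^]\<^bsub>G\<^esub> c x) = (\<Otimes>\<^bsub>H\<^esub>x\<in>S. h x [^]\<^bsub>H\<^esub> (c x :: int))"
  using assms(3,4)
proof (induction S rule: finite_induct)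
  case empty
  show ?case
    using assms(1,2) by (simp add: comm_group_def comm_monoid.finprod_empty)
next
  case (insert a S)
  interpret G: comm_group G by fact
  interpret H: comm_group H by fact
  from insert show ?case
    by (subst G.finprod_insert H.finprod_insert; auto simp: Pi_iff hom_int_pow subset_iff)+
qed

lemma finprod_free_Abelian_group:
  assumes "finite S" "f \<in> S \<rightarrow> carrier (free_Abelian_group X)"
  shows "finprod (free_Abelian_group X) f S = sum f S"
  using assms
proof (induction S rule: finite_induct)
  case empty
  then show ?case
    by (simp add: abelian_free_Abelian_group comm_group.axioms(1) comm_monoid.finprod_empty)
next
  case (insert a S)
  interpret F: comm_group "free_Abelian_group X" by (rule abelian_free_Abelian_group)
  from insert show ?case
    by (subst F.finprod_insert) (auto simp: Pi_iff)
qed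

text \<open>Torsion-freeness is read off from integer coordinates. The preimages of the generators
  are independent, while more than \<open>card X\<close> elements satisfy a nontrivial relation by
  \<open>int_linear_dependence\<close>.\<close>

lemma torsion_free_and_rank_if_iso_free:
  assumes h: "h \<in> iso A (free_Abelian_group X)" and A: "group A" and X: "finite X"
  shows "torsion_free A" "ab_rank A = enat (card X)"
proof -
  let ?F = "free_Abelian_group X"
  interpret A: comm_group A
    by (rule comm_group.iso_imp_comm_group[OF abelian_free_Abelian_group[of X]])
      (use h A in \<open>auto simp: is_iso_def intro: group.iso_set_sym group.is_monoid\<close>)
  interpret F: comm_group ?F by (rule abelian_free_Abelian_group)
  have hom: "h \<in> hom A ?F" and inj: "inj_on h (carrier A)"
    and surj: "h ` carrier A = carrier ?F"
    using h by (auto simp: iso_def bij_betw_def)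
  interpret h: group_hom A ?F h
    using hom by unfold_locales
  have h0: "x = \<one>\<^bsub>A\<^esub>" if "x \<in> carrier A" "h x = 0" for x
    using that inj h.hom_one by (metis A.one_closed inj_onD one_free_Abelian_group)
  have keys: "Poly_Mapping.keys (h x) \<subseteq> X" if "x \<in> carrier A" for x
    using h.hom_closed[OF that] by simp
  show "torsion_free A"
    unfolding torsion_free_def
  proof (intro ballI allI impI)
    fix x and n :: nat
    assume x: "x \<in> carrier A" and n: "0 < n" "x [^]\<^bsub>A\<^esub> n = \<one>\<^bsub>A\<^esub>"
    then have "frag_cmul (int n) (h x) = 0"
      using h.hom_nat_pow[of x n] h.hom_one by simp
    then have "int n * Poly_Mapping.lookup (h x) y = 0" for y
      by (metis lookup_frag_cmul lookup_zero)
    with n have "h x = 0"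
      by (intro poly_mapping_eqI) auto
    with x show "x = \<one>\<^bsub>A\<^esub>" using h0 by blast
  qed
  \<comment> \<open>Passes from the multiplicative notation of \<open>A\<close> to integer
    combinations of coordinate vectors.\<close>
  have comb: "h (\<Otimes>\<^bsub>A\<^esub>x\<in>S. x [^]\<^bsub>A\<^esub> c x) = (\<Sum>x\<in>S. frag_cmul (c x) (h x))"
    if "finite S" "S \<subseteq> carrier A" for S and c :: "_ \<Rightarrow> int"
  proof -
    have "h (\<Otimes>\<^bsub>A\<^esub>x\<in>S. x [^]\<^bsub>A\<^esub> c x) = (\<Otimes>\<^bsub>?F\<^esub>x\<in>S. h x [^]\<^bsub>?F\<^esub> c x)"
      using that by (intro h.hom_finprod_int_pow A.comm_group_axioms F.comm_group_axioms)
    also have "\<dots> = (\<Sum>x\<in>S. h x [^]\<^bsub>?F\<^esub> c x)"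
      using that by (intro finprod_free_Abelian_group Pi_I F.int_pow_closed h.hom_closed) auto
    also have "\<dots> = (\<Sum>x\<in>S. frag_cmul (c x) (h x))"
      using that keys by (intro sum.cong int_pow_free_Abelian_group) auto
    finally show ?thesis .
  qed
  have le: "card S \<le> card X" if S: "int_independent A S" for S
  proof (rule ccontr)
    assume "\<not> card S \<le> card X"
    then have less: "card X < card S" by simp
    have S': "finite S" "S \<subseteq> carrier A"
      using S by (auto simp: int_independent_def)
    obtain c :: "_ \<Rightarrow> int" where c: "\<exists>s\<in>S. c s \<noteq> 0"
      "\<forall>x\<in>X. (\<Sum>s\<in>S. c s * Poly_Mapping.lookup (h s) x) = 0"
      using int_linear_dependence[OF X S'(1) less, of "\<lambda>s. Poly_Mapping.lookup (h s)"] by blast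
    \<comment> \<open>The relation was found on \<open>X\<close> only; off \<open>X\<close> all
      coordinates vanish by \<open>keys\<close>.\<close>
    have "(\<Sum>s\<in>S. c s * Poly_Mapping.lookup (h s) x) = 0" for x
    proof (cases "x \<in> X")
      case False
      with keys S' have "Poly_Mapping.lookup (h s) x = 0" if "s \<in> S" for s
        using that by (metis in_keys_iff subset_iff)
      then show ?thesis by simp
    qed (use c in simp)
    then have "h (\<Otimes>\<^bsub>A\<^esub>x\<in>S. x [^]\<^bsub>A\<^esub> c x) = 0"
      unfolding comb[OF S'] by (intro poly_mapping_eqI) (simp add: lookup_sum)
    moreover have "(\<Otimes>\<^bsub>A\<^esub>x\<in>S. x [^]\<^bsub>A\<^esub> c x) \<in> carrier A"
      using S' by (intro A.finprod_closed) auto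
    ultimately have "(\<Otimes>\<^bsub>A\<^esub>x\<in>S. x [^]\<^bsub>A\<^esub> c x) = \<one>\<^bsub>A\<^esub>"
      using h0 by blast
    with S c(1) show False
      by (auto simp: int_independent_def)
  qed
  \<comment> \<open>The standard basis, pulled back along \<open>h\<close>.\<close>
  define S where "S = inv_into (carrier A) h ` frag_of ` X"
  have S: "S \<subseteq> carrier A" "finite S"
    using X surj by (auto simp: S_def intro!: inv_into_into)
  have hS: "h (inv_into (carrier A) h (frag_of x)) = frag_of x" if "x \<in> X" for x
    using that surj by (intro f_inv_into_f) auto
  have injS: "inj_on (\<lambda>x. inv_into (carrier A) h (frag_of x)) X"
    by (rule inj_onI) (metis hS frag_of_eq)
  have "int_independent A S"
    unfolding int_independent_def
  proof (intro conjI allI impI S)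
    fix c :: "_ \<Rightarrow> int"
    let ?g = "\<lambda>x. inv_into (carrier A) h (frag_of x)"
    assume "(\<Otimes>\<^bsub>A\<^esub>x\<in>S. x [^]\<^bsub>A\<^esub> c x) = \<one>\<^bsub>A\<^esub>"
    then have "(\<Sum>s\<in>S. frag_cmul (c s) (h s)) = 0"
      using comb[OF S(2,1), of c] h.hom_one by simp
    also have "(\<Sum>s\<in>S. frag_cmul (c s) (h s)) = (\<Sum>x\<in>X. frag_cmul (c (?g x)) (frag_of x))"
      unfolding S_def image_image using hS by (subst sum.reindex[OF injS]) simp
    finally have *: "(\<Sum>x\<in>X. frag_cmul (c (?g x)) (frag_of x)) = 0" .
    have "c (?g y) = 0" if "y \<in> X" for y
    proof -
      have "0 = Poly_Mapping.lookup (\<Sum>x\<in>X. frag_cmul (c (?g x)) (frag_of x)) y"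
        using * by simp
      also have "\<dots> = (\<Sum>x\<in>X. if x = y then c (?g x) else 0)"
        by (subst lookup_sum, rule sum.cong) auto
      finally show ?thesis using that X by simp
    qed
    then show "\<forall>x\<in>S. c x = 0" by (auto simp: S_def)
  qed
  moreover have "card S = card X"
    unfolding S_def image_image by (rule card_image[OF injS])
  ultimately have "enat (card X) \<le> ab_rank A"
    unfolding ab_rank_def by (metis (mono_tags) SUP_upper mem_Collect_eq)
  moreover have "ab_rank A \<le> enat (card X)"
    unfolding ab_rank_def using le by (auto intro: SUP_least)
  ultimately show "ab_rank A = enat (card X)" by simp
qed

section \<open>Graphs without short cycles\<close>

text \<open>For a simple graph: girth at least 5. A closed walk of length 3 is then a genuine
  triangle, but one of length 4 may run back along an edge, hence the disjunction in the second
  clause.\<close>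

definition no_short_cycles :: "'a ugraph \<Rightarrow> bool" where
  "no_short_cycles G \<longleftrightarrow>
     (\<forall>a b c. {a, b} \<in> edges G \<longrightarrow> {b, c} \<in> edges G \<longrightarrow> {a, c} \<notin> edges G) \<and>
     (\<forall>a b c d. {a, b} \<in> edges G \<longrightarrow> {b, c} \<in> edges G \<longrightarrow> {c, d} \<in> edges G \<longrightarrow> {a, d} \<in> edges G \<longrightarrow>
        a = c \<or> b = d)"

lemma no_short_cyclesD:
  assumes "no_short_cycles G"
  shows "{a, b} \<in> edges G \<Longrightarrow> {b, c} \<in> edges G \<Longrightarrow> {a, c} \<in> edges G \<Longrightarrow> False"
    and "{a, b} \<in> edges G \<Longrightarrow> {b, c} \<in> edges G \<Longrightarrow> {c, d} \<in> edges G \<Longrightarrow> {a, d} \<in> edges G \<Longrightarrow>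
      a = c \<or> b = d"
  using assms unfolding no_short_cycles_def by meson+

lemma simple_graph_edge:
  assumes "simple_graph G" "{u, v} \<in> edges G"
  shows "u \<in> verts G" "v \<in> verts G" "u \<noteq> v"
  using assms by (force simp: simple_graph_def)+

lemma no_short_cycles_K2:
  assumes "is_K2 H" shows "no_short_cycles H"
  using assms by (auto simp: is_K2_def no_short_cycles_def doubleton_eq_iff)

text \<open>Each edge moves the index one step forward or back around the cycle. A closed walk of 3
  or 4 edges that never turns back would close up after that many steps in one direction, which
  \<open>n \<ge> 5\<close> forbids.\<close>

lemma no_short_cycles_cycle:
  assumes "is_cycle_graph n H" "n \<ge> 5" shows "no_short_cycles H"
proof -
  obtain f :: "nat \<Rightarrow> 'a" where inj: "inj_on f {..<n}"
    and H: "edges H = (\<lambda>i. {f i, f (Suc i mod n)}) ` {..<n}"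
    using assms by (auto simp: is_cycle_graph_def)
  define s where "s i = Suc i mod n" for i
  define N where "N i j \<longleftrightarrow> j = s i \<or> i = s j" for i j
  have s: "s i = (if Suc i = n then 0 else Suc i)" if "i < n" for i
    using that by (simp add: s_def)
  have s_less: "s i < n" for i
    using assms(2) by (simp add: s_def)
  have s_inj: "i = j" if "s i = s j" "i < n" "j < n" for i j
    using that by (auto simp: s split: if_splits)
  have s_s: "s (s i) = (if n \<le> i + 2 then i + 2 - n else i + 2)" if "i < n" for i
    using that s_less[of i] assms(2) by (auto simp: s[OF that] s)
  \<comment> \<open>Here \<open>n \<ge> 5\<close> is decisive: one to four steps forward never
    return to the start.\<close>
  have s_neq: "s i \<noteq> i" "s (s i) \<noteq> i" "s (s (s i)) \<noteq> i" "s (s (s (s i))) \<noteq> i" if "i < n" for i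
    using that assms(2) s_less[of i] s_less[of "s i"] by (auto simp: s_s s)
  have edge: "\<exists>i j. i < n \<and> j < n \<and> u = f i \<and> v = f j" if "{u, v} \<in> edges H" for u v
  proof -
    from that obtain i where "i < n" "{u, v} = {f i, f (s i)}"
      unfolding H s_def by (elim imageE) simp
    with s_less show ?thesis by (auto simp: doubleton_eq_iff)
  qed
  have adj: "N i j" if ij: "{f i, f j} \<in> edges H" "i < n" "j < n" for i j
  proof -
    obtain l where "l < n" "{f i, f j} = {f l, f (s l)}"
      using ij(1) unfolding H s_def by (elim imageE) simp
    with s_less[of l] show ?thesis
      using ij inj by (auto simp: doubleton_eq_iff inj_on_eq_iff N_def)
  qed
  \<comment> \<open>Three steps in one direction contradict \<open>s_neq\<close>; a change of
    direction identifies two indices that are also adjacent.\<close>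
  have tri: "\<not> N i l" if "N i j" "N j l" "i < n" "j < n" "l < n" for i j l
    using that s_inj s_neq unfolding N_def by metis
  \<comment> \<open>Either all four steps have one direction, or a change of direction at an index
    identifies its two neighbours, which are opposite corners.\<close>
  have quad: "i = l \<or> j = m" if "N i j" "N j l" "N l m" "N i m" "i < n" "j < n" "l < n" "m < n" for i j l m
    using that s_inj s_neq(4) unfolding N_def by metis
  show ?thesis
    unfolding no_short_cycles_def
  proof (intro conjI allI impI)
    fix a b c
    assume *: "{a, b} \<in> edges H" "{b, c} \<in> edges H"
    show "{a, c} \<notin> edges H"
      using edge[OF *(1)] edge[OF *(2)] * adj tri by metis
  next
    fix a b c d
    assume *: "{a, b} \<in> edges H" "{b, c} \<in> edges H" "{c, d} \<in> edges H" "{a, d} \<in> edges H"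
    then obtain i j l m where "a = f i" "b = f j" "c = f l" "d = f m" "i < n" "j < n" "l < n" "m < n"
      using edge by metis
    with * adj quad show "a = c \<or> b = d" by metis
  qed
qed

text \<open>A cycle through both sides has two vertices in the clique \<open>e\<close>; for length at most 4 they are
  joined by a chord, or the cycle degenerates.\<close>

lemma no_short_cycles_union:
  assumes G: "simple_graph G" "no_short_cycles G" and H: "simple_graph H" "no_short_cycles H"
    and int: "verts G \<inter> verts H = e" "e \<in> edges G \<and> e \<in> edges H \<or> is_singleton e"
  shows "no_short_cycles (graph_union G H)"
proof -
  \<comment> \<open>Predicates in place of memberships make the case distinctions below
    propositional.\<close>
  define A where "A u v \<longleftrightarrow> {u, v} \<in> edges G" for u v
  define B where "B u v \<longleftrightarrow> {u, v} \<in> edges H" for u v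
  define VG where "VG u \<longleftrightarrow> u \<in> verts G" for u
  define VH where "VH u \<longleftrightarrow> u \<in> verts H" for u
  have A: "VG u \<and> VG v \<and> u \<noteq> v \<and> A v u" if "A u v" for u v
    using that simple_graph_edge[OF G(1)] by (auto simp: A_def VG_def insert_commute)
  have B: "VH u \<and> VH v \<and> u \<noteq> v \<and> B v u" if "B u v" for u v
    using that simple_graph_edge[OF H(1)] by (auto simp: B_def VH_def insert_commute)
  \<comment> \<open>Two distinct common vertices rule out a singleton overlap, so they are the two
    ends of the shared edge \<open>e\<close>.\<close>
  have clique: "A u v \<and> B u v" if "VG u" "VH u" "VG v" "VH v" "u \<noteq> v" for u v
  proof -
    have uv: "{u, v} \<subseteq> e" using that int by (auto simp: VG_def VH_def)
    with that have "\<not> is_singleton e" by (auto simp: is_singleton_def)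
    with int have e: "e \<in> edges G" "e \<in> edges H" by auto
    with G have "card e = 2" by (auto simp: simple_graph_def)
    with uv that have "{u, v} = e" by (intro card_subset_eq) (auto intro: card_ge_0_finite)
    with e show ?thesis by (simp add: A_def B_def)
  qed
  have tri: "A a b \<Longrightarrow> A b c \<Longrightarrow> A a c \<Longrightarrow> False" "B a b \<Longrightarrow> B b c \<Longrightarrow> B a c \<Longrightarrow> False" for a b c
    unfolding A_def B_def by (fact no_short_cyclesD(1)[OF G(2)], fact no_short_cyclesD(1)[OF H(2)])
  have quad: "A a b \<Longrightarrow> A b c \<Longrightarrow> A c d \<Longrightarrow> A a d \<Longrightarrow> a = c \<or> b = d"
    "B a b \<Longrightarrow> B b c \<Longrightarrow> B c d \<Longrightarrow> B a d \<Longrightarrow> a = c \<or> b = d" for a b c d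
    unfolding A_def B_def by (fact no_short_cyclesD(2)[OF G(2)], fact no_short_cyclesD(2)[OF H(2)])
  define C where "C u v \<longleftrightarrow> A u v \<or> B u v" for u v
  have edge: "{u, v} \<in> edges (graph_union G H) \<longleftrightarrow> C u v" for u v
    by (simp add: graph_union_def A_def B_def C_def)
  have sym: "C v u" if "C u v" for u v
    using that A B unfolding C_def by blast
  have inA: "A u v" if "C u v" "VG u" "VG v" for u v
    using that B clique unfolding C_def by blast
  have inB: "B u v" if "C u v" "VH u" "VH v" for u v
    using that A clique unfolding C_def by blast
  have sides: "VG u \<and> VG v \<or> VH u \<and> VH v" "VG u \<or> VH u" if "C u v" for u v
    using that A B unfolding C_def by blast+
  \<comment> \<open>The neighbours of \<open>a\<close> lie in \<open>H\<close> and those of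
    \<open>c\<close> in \<open>G\<close>, so \<open>b\<close> and \<open>d\<close> are common
    vertices. If distinct, they are joined by a chord, and \<open>a\<close>, \<open>b\<close>,
    \<open>d\<close> form a triangle in \<open>H\<close>.\<close>
  have across: "b = d" if "C a b" "C b c" "C c d" "C a d" "\<not> VG a" "\<not> VH c" for a b c d
  proof (rule ccontr)
    assume "b \<noteq> d"
    moreover have "VG b" "VH b" "VG d" "VH d"
      using that sides by blast+
    ultimately have "B b d" using clique by blast
    moreover have "B a b" "B a d"
      using that A unfolding C_def by blast+
    ultimately show False using tri(2) by blast
  qed
  show ?thesis
    unfolding no_short_cycles_def edge
  proof (intro conjI allI impI notI)
    fix a b c
    assume *: "C a b" "C b c" "C a c"
    \<comment> \<open>A vertex off one side forces both of its neighbours, hence the whole triangle,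
      onto the other side.\<close>
    then have "VG a \<and> VG b \<and> VG c \<or> VH a \<and> VH b \<and> VH c"
      using sides by blast
    with * show False
      by (metis inA inB tri)
  next
    fix a b c d
    assume *: "C a b" "C b c" "C c d" "C a d"
    \<comment> \<open>If neither side contains the cycle, one vertex is missing from
      \<open>G\<close> and another from \<open>H\<close>. Adjacent vertices share a side, so these
      two are opposite.\<close>
    consider "VG a" "VG b" "VG c" "VG d" | "VH a" "VH b" "VH c" "VH d"
      | "\<not> VG a" "\<not> VH c" | "\<not> VG c" "\<not> VH a" | "\<not> VG b" "\<not> VH d" | "\<not> VG d" "\<not> VH b"
      using *[THEN sides(1)] *[THEN sides(2)] by satx
    then show "a = c \<or> b = d"
    proof cases
      case 1
      with * show ?thesis by (intro quad(1) inA)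
    next
      case 2
      with * show ?thesis by (intro quad(2) inB)
    next
      case 3
      with * show ?thesis using across[of a b c d] by blast
    next
      case 4
      with * show ?thesis using across[of c b a d] sym by blast
    next
      case 5
      with * show ?thesis using across[of b a d c] sym by blast
    next
      case 6
      with * show ?thesis using across[of d a b c] sym by blast
    qed
  qed
qed

text \<open>Induction over the gluing steps: the overlap is a single vertex or an edge of both
  graphs, as \<open>no_short_cycles_union\<close> requires.\<close>

lemma no_short_cycles_outerplanar:
  assumes "outerplanar_decomposition G Hs"
    and "\<forall>H\<in>set Hs. is_K2 H \<or> (\<exists>n. even n \<and> n \<noteq> 4 \<and> is_cycle_graph n H)"
  shows "no_short_cycles G"
proof -
  have comp: "no_short_cycles H"
    if "is_K2 H \<or> (\<exists>n. even n \<and> n \<noteq> 4 \<and> is_cycle_graph n H)" for H :: "'a ugraph"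
    using that
  proof (elim disjE exE conjE)
    fix n assume n: "even n" "n \<noteq> 4" "is_cycle_graph n H"
    \<comment> \<open>Parity excludes triangles; with \<open>n \<noteq> 4\<close> the length is at
      least 5.\<close>
    then have "n \<noteq> 3" "n \<ge> 3" by (auto simp: is_cycle_graph_def)
    with n(2) have "n \<ge> 5" by linarith
    with n(3) show ?thesis by (rule no_short_cycles_cycle)
  qed (rule no_short_cycles_K2)
  from assms show ?thesis
  proof (induction rule: outerplanar_decomposition.induct)
    case (single H)
    then show ?case using comp by simp
  next
    case (glue_vertex G Hs H p \<gamma> v)
    then have "no_short_cycles G" "no_short_cycles H"
      by (simp_all add: comp)
    with glue_vertex.hyps show ?case
      by (intro no_short_cycles_union[where e = "{v}"])
        (simp_all add: outerplanar_decomposition_simple_graph simple_graph_component)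
  next
    case (glue_edge G Hs H p \<gamma> e)
    then have "no_short_cycles G" "no_short_cycles H"
      by (simp_all add: comp)
    with glue_edge.hyps show ?case
      by (intro no_short_cycles_union[where e = e])
        (simp_all add: outerplanar_decomposition_simple_graph simple_graph_component edge_on_outer_face_def)
  qed
qed

section \<open>Distances one and two in terms of adjacency\<close>

lemma gdist_le_1:
  assumes "simple_graph G" "{x, y} \<in> edges G" shows "gdist G x y \<le> 1"
proof -
  have "walk_betw G x [x, y] y"
    using assms simple_graph_edge[OF assms] by (auto simp: walk_betw_def)
  then have "gdist G x y \<le> enat (length [x, y] - 1)"
    unfolding gdist_def by (intro INF_lower) simp
  then show ?thesis by (simp add: one_enat_def)
qed

lemma gdist_le_2:
  assumes "simple_graph G" "{x, z} \<in> edges G" "{z, y} \<in> edges G" shows "gdist G x y \<le> enat 2"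
proof -
  have "walk_betw G x [x, z, y] y"
    using assms simple_graph_edge[OF assms(1,2)] simple_graph_edge[OF assms(1,3)]
    by (auto simp: walk_betw_def)
  then have "gdist G x y \<le> enat (length [x, z, y] - 1)"
    unfolding gdist_def by (intro INF_lower) simp
  then show ?thesis by (simp add: numeral_2_eq_2)
qed

lemma gdist_ge_1:
  assumes "x \<noteq> y" shows "gdist G x y \<ge> 1"
  unfolding gdist_def
proof (intro INF_greatest)
  fix xs assume "xs \<in> {xs. walk_betw G x xs y}"
  with assms have "length xs - 1 \<ge> 1"
    \<comment> \<open>The rule separates lists with no, one and at least two entries; the first two
      kinds cannot join distinct vertices.\<close>
    by (cases xs rule: remdups_adj.cases) (auto simp: walk_betw_def)
  then show "1 \<le> enat (length xs - 1)" by (simp add: one_enat_def)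
qed

lemma gdist_ge_2:
  assumes "x \<noteq> y" "{x, y} \<notin> edges G" shows "gdist G x y \<ge> enat 2"
  unfolding gdist_def
proof (intro INF_greatest)
  fix xs assume xs: "xs \<in> {xs. walk_betw G x xs y}"
  show "enat 2 \<le> enat (length xs - 1)"
  proof (cases xs rule: remdups_adj.cases)
    case (3 a b ys)
    \<comment> \<open>For \<open>ys = []\<close> the walk would be the missing edge; otherwise it
      has at least three entries.\<close>
    with xs assms show ?thesis by (cases ys) (auto simp: walk_betw_def)
  qed (use xs assms in \<open>auto simp: walk_betw_def\<close>)
qed

lemma gdist_edge:
  assumes "simple_graph G" "{x, y} \<in> edges G" shows "gdist G x y = 1"
  using gdist_le_1[OF assms] gdist_ge_1[OF simple_graph_edge(3)[OF assms]] by (rule antisym)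

section \<open>The main diagonal\<close>

lemma sum_enat: "(\<Sum>i\<in>A. enat (f i)) = enat (sum f A)"
  by (simp flip: of_nat_eq_enat)

text \<open>Consecutive entries differ, so each step costs at least 1. This makes the chain group of
  degree \<open>Suc k\<close> and length \<open>k\<close> trivial.\<close>

lemma kpaths_length_ge:
  assumes "xs \<in> kpaths G k l" shows "k \<le> l"
proof -
  have "(\<Sum>i<k. 1) \<le> (\<Sum>i<k. gdist G (xs ! i) (xs ! Suc i))"
    using assms by (intro sum_mono gdist_ge_1) (auto simp: kpaths_def)
  also have "\<dots> = enat l" using assms by (simp add: kpaths_def)
  finally show ?thesis by (simp add: of_nat_eq_enat)
qed

text \<open>All \<open>k\<close> steps cost at least 1, and a step between nonadjacent vertices at
  least 2, which would push the total beyond \<open>k\<close>.\<close>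

lemma kpaths_diagonal_edge:
  assumes xs: "xs \<in> kpaths G k k" and i: "i < k"
  shows "{xs ! i, xs ! Suc i} \<in> edges G"
proof (rule ccontr)
  assume *: "{xs ! i, xs ! Suc i} \<notin> edges G"
  have "enat (\<Sum>j<k. 1 + (if j = i then 1 else 0)) \<le> (\<Sum>j<k. gdist G (xs ! j) (xs ! Suc j))"
    unfolding sum_enat[symmetric]
  proof (rule sum_mono)
    fix j assume "j \<in> {..<k}"
    then have "xs ! j \<noteq> xs ! Suc j" using xs by (simp add: kpaths_def)
    then show "enat (1 + (if j = i then 1 else 0)) \<le> gdist G (xs ! j) (xs ! Suc j)"
      using gdist_ge_1[of "xs ! j" "xs ! Suc j" G] gdist_ge_2[of "xs ! j" "xs ! Suc j" G] *
      by (auto simp: one_enat_def numeral_2_eq_2)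
  qed
  moreover have "(\<Sum>j<k. 1 + (if j = i then 1 else 0)) = Suc k"
    using i unfolding sum.distrib by simp
  ultimately show False using xs by (simp add: kpaths_def)
qed

lemma kpaths_diagonal:
  assumes "simple_graph G"
  shows "kpaths G k k =
    {xs. length xs = Suc k \<and> set xs \<subseteq> verts G \<and> (\<forall>i<k. {xs ! i, xs ! Suc i} \<in> edges G)}"
proof (intro Set.set_eqI iffI)
  fix xs assume "xs \<in> kpaths G k k"
  then show "xs \<in> {xs. length xs = Suc k \<and> set xs \<subseteq> verts G \<and> (\<forall>i<k. {xs ! i, xs ! Suc i} \<in> edges G)}"
    using kpaths_diagonal_edge[of xs G k] by (auto simp: kpaths_def)
next
  fix xs
  assume xs: "xs \<in> {xs. length xs = Suc k \<and> set xs \<subseteq> verts G \<and> (\<forall>i<k. {xs ! i, xs ! Suc i} \<in> edges G)}"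
  then have "(\<Sum>i<k. gdist G (xs ! i) (xs ! Suc i)) = (\<Sum>i<k. 1)"
    using gdist_edge[OF assms] by (intro sum.cong) auto
  with xs show "xs \<in> kpaths G k k"
    using simple_graph_edge(3)[OF assms] gdist_edge[OF assms]
    by (auto simp: kpaths_def of_nat_eq_enat one_enat_def)
qed

section \<open>Faces of walks\<close>

definition delete_nth :: "nat \<Rightarrow> 'a list \<Rightarrow> 'a list" where
  "delete_nth i xs = take i xs @ drop (Suc i) xs"

lemma length_delete_nth: "i < length xs \<Longrightarrow> length (delete_nth i xs) = length xs - 1"
  by (simp add: delete_nth_def)

lemma nth_delete_nth:
  "i < length xs \<Longrightarrow> j < length xs - 1 \<Longrightarrow>
    delete_nth i xs ! j = (if j < i then xs ! j else xs ! Suc j)"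
  by (auto simp: delete_nth_def nth_append)

lemma set_delete_nth: "set (delete_nth i xs) \<subseteq> set xs"
  by (auto simp: delete_nth_def dest: in_set_takeD in_set_dropD)

text \<open>If the neighbours of the deleted entry agree, the face repeats a vertex. If they differ,
  the absence of triangles puts them at distance exactly 2, so the length is preserved.\<close>

lemma delete_nth_in_kpaths_iff:
  assumes G: "simple_graph G" "no_short_cycles G" and xs: "xs \<in> kpaths G k k" and i: "1 \<le> i" "i < k"
  shows "delete_nth i xs \<in> kpaths G (k - 1) k \<longleftrightarrow> xs ! (i - 1) \<noteq> xs ! Suc i"
proof
  let ?ys = "delete_nth i xs"
  have len: "length xs = Suc k" and set: "set xs \<subseteq> verts G" and edge: "\<And>j. j < k \<Longrightarrow> {xs ! j, xs ! Suc j} \<in> edges G"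
    using xs by (auto simp: kpaths_diagonal[OF G(1)])
  have nth: "?ys ! j = (if j < i then xs ! j else xs ! Suc j)" if "j < k" for j
    using that i len by (intro nth_delete_nth) auto
  {
    assume "?ys \<in> kpaths G (k - 1) k"
    moreover have "i - 1 < k - 1" using i by simp
    ultimately have "?ys ! (i - 1) \<noteq> ?ys ! Suc (i - 1)"
      unfolding kpaths_def by blast
    with i show "xs ! (i - 1) \<noteq> xs ! Suc i"
      by (simp add: nth)
  next
    assume neq: "xs ! (i - 1) \<noteq> xs ! Suc i"
    have e: "{xs ! (i - 1), xs ! i} \<in> edges G" "{xs ! i, xs ! Suc i} \<in> edges G"
      using edge[of "i - 1"] edge[of i] i by auto
    have gap: "gdist G (xs ! (i - 1)) (xs ! Suc i) = enat 2"
      using gdist_ge_2[OF neq, of G] gdist_le_2[OF G(1) e] no_short_cyclesD(1)[OF G(2) e]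
      by (meson antisym)
    \<comment> \<open>The gap sits at position \<open>i - 1\<close> of the face; later entries are
      shifted down by one.\<close>
    have dist: "gdist G (?ys ! j) (?ys ! Suc j) = enat (1 + (if j = i - 1 then 1 else 0))"
      and ne: "?ys ! j \<noteq> ?ys ! Suc j" if j: "j < k - 1" for j
    proof -
      consider "Suc j < i" | "j = i - 1" | "i \<le> j" by linarith
      then have "gdist G (?ys ! j) (?ys ! Suc j) = enat (1 + (if j = i - 1 then 1 else 0)) \<and>
        ?ys ! j \<noteq> ?ys ! Suc j"
      proof cases
        case 1
        with i j edge[of j] show ?thesis
          using gdist_edge[OF G(1)] simple_graph_edge(3)[OF G(1)] by (auto simp: nth one_enat_def)
      next
        case 2
        with i gap neq show ?thesis by (simp add: nth numeral_2_eq_2)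
      next
        case 3
        with i j edge[of "Suc j"] show ?thesis
          using gdist_edge[OF G(1)] simple_graph_edge(3)[OF G(1)] by (auto simp: nth one_enat_def)
      qed
      then show "gdist G (?ys ! j) (?ys ! Suc j) = enat (1 + (if j = i - 1 then 1 else 0))"
        "?ys ! j \<noteq> ?ys ! Suc j" by auto
    qed
    have "(\<Sum>j<k - 1. gdist G (?ys ! j) (?ys ! Suc j)) = enat (\<Sum>j<k - 1. 1 + (if j = i - 1 then 1 else 0))"
      using dist by (simp add: sum_enat[symmetric])
    also have "(\<Sum>j<k - 1. 1 + (if j = i - 1 then 1 else 0)) = k"
      using i unfolding sum.distrib by auto
    finally show "?ys \<in> kpaths G (k - 1) k"
      using i len set set_delete_nth[of i xs] ne dist
      by (auto simp: kpaths_def length_delete_nth)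
  }
qed

text \<open>The deleted position is the only place where consecutive entries of the face are not adjacent
  (no triangles), and the deleted vertex is the unique common neighbour there (no 4-cycles).\<close>

lemma delete_nth_cancel:
  assumes G: "simple_graph G" "no_short_cycles G"
    and xs: "xs \<in> kpaths G k k" and i: "1 \<le> i" "i < k"
    and xs': "xs' \<in> kpaths G k k" and i': "1 \<le> i'" "i' < k"
    and eq: "delete_nth i xs = delete_nth i' xs'" and mem: "delete_nth i xs \<in> kpaths G (k - 1) k"
  shows "i = i' \<and> xs = xs'"
proof -
  \<comment> \<open>If \<open>p < q\<close>, the entries around the gap left in \<open>x\<close> are
    consecutive in \<open>y\<close>, hence adjacent, and close a triangle with \<open>x ! p\<close>.
    Exchanging the walks then gives equality of the positions.\<close>
  have le: "q \<le> p" if x: "x \<in> kpaths G k k" "1 \<le> p" "p < k" and y: "y \<in> kpaths G k k" "1 \<le> q" "q < k"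
    and xy: "delete_nth p x = delete_nth q y" for x y p q
  proof (rule ccontr)
    assume "\<not> q \<le> p"
    have len: "length x = Suc k" "length y = Suc k"
      using x y by (auto simp: kpaths_def)
    have "delete_nth p x ! j = delete_nth q y ! j" for j
      using xy by simp
    moreover have "p < q" "p - 1 < q"
      using \<open>\<not> q \<le> p\<close> by auto
    ultimately have "x ! (p - 1) = y ! (p - 1)" "x ! Suc p = y ! p"
      using x y len nth_delete_nth[of p x "p - 1"] nth_delete_nth[of q y "p - 1"]
        nth_delete_nth[of p x p] nth_delete_nth[of q y p] by (simp_all split: if_splits)
    moreover have "{y ! (p - 1), y ! p} \<in> edges G"
      using kpaths_diagonal_edge[OF y(1), of "p - 1"] x by simp
    moreover have "{x ! (p - 1), x ! p} \<in> edges G" "{x ! p, x ! Suc p} \<in> edges G"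
      using kpaths_diagonal_edge[OF x(1), of "p - 1"] kpaths_diagonal_edge[OF x(1), of p] x by auto
    ultimately show False
      using no_short_cyclesD(1)[OF G(2)] by metis
  qed
  have ii': "i = i'"
    using le[OF xs i xs' i' eq] le[OF xs' i' xs i eq[symmetric]] by simp
  have len: "length xs = Suc k" "length xs' = Suc k"
    using xs xs' by (auto simp: kpaths_def)
  have same: "xs ! j = xs' ! j" if "j < Suc k" "j \<noteq> i" for j
  proof -
    have "delete_nth i xs ! (if j < i then j else j - 1) = delete_nth i xs' ! (if j < i then j else j - 1)"
      using eq ii' by simp
    with that i len show ?thesis
      by (auto simp: nth_delete_nth split: if_splits)
  qed
  \<comment> \<open>A nonzero face has distinct vertices around the gap; without this the deleted
    vertex would not be determined.\<close>
  have neq: "xs ! (i - 1) \<noteq> xs ! Suc i"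
    using mem delete_nth_in_kpaths_iff[OF G xs i] by simp
  have "{xs ! (i - 1), xs ! i} \<in> edges G" "{xs ! i, xs ! Suc i} \<in> edges G"
    using kpaths_diagonal_edge[OF xs, of "i - 1"] kpaths_diagonal_edge[OF xs, of i] i by auto
  moreover have "{xs ! (i - 1), xs' ! i} \<in> edges G" "{xs ! Suc i, xs' ! i} \<in> edges G"
    using kpaths_diagonal_edge[OF xs', of "i - 1"] kpaths_diagonal_edge[OF xs', of i] i
      same[of "i - 1"] same[of "Suc i"] by (auto simp: insert_commute)
  \<comment> \<open>Both deleted vertices are common neighbours of the two distinct ends of the
    gap.\<close>
  ultimately have "xs ! i = xs' ! i"
    using no_short_cyclesD(2)[OF G(2)] neq by metis
  with same len have "xs = xs'"
    by (intro nth_equalityI) metis+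
  with ii' show ?thesis by simp
qed

section \<open>Cycles and homology on the diagonal\<close>

text \<open>The condition is vacuous for \<open>k \<le> 1\<close>, where the differential is
  0.\<close>

definition backtracking_walks :: "'a ugraph \<Rightarrow> nat \<Rightarrow> 'a list set" where
  "backtracking_walks G k = {xs \<in> kpaths G k k. \<forall>i\<in>{1..<k}. xs ! (i - 1) = xs ! Suc i}"

lemma lookup_MC_boundary:
  "Poly_Mapping.lookup (MC_boundary G k l c) ys =
    (\<Sum>xs\<in>Poly_Mapping.keys c. \<Sum>i\<in>{1..<k}.
      if delete_nth i xs = ys \<and> ys \<in> kpaths G (k - 1) l then Poly_Mapping.lookup c xs * (-1) ^ i else 0)"
  unfolding MC_boundary_def frag_extend_def lookup_sum lookup_frag_cmul sum_distrib_left
  by (intro sum.cong refl) (auto simp: MC_face_def delete_nth_def Let_def)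

text \<open>No cancellation can occur: by \<open>delete_nth_cancel\<close> a nonzero face comes from
  one walk at one position, so its coefficient in the boundary is that of the walk up to sign. All
  faces of a backtracking walk are 0.\<close>

lemma MC_cycles_diagonal:
  assumes G: "simple_graph G" "no_short_cycles G"
  shows "MC_cycles G k k = carrier (free_Abelian_group (backtracking_walks G k))"
proof (intro Set.set_eqI iffI)
  fix c assume "c \<in> MC_cycles G k k"
  then have c: "Poly_Mapping.keys c \<subseteq> kpaths G k k" and c0: "MC_boundary G k k c = 0"
    by (auto simp: MC_cycles_def MC_def)
  have "xs ! (i - 1) = xs ! Suc i" if xs: "xs \<in> Poly_Mapping.keys c" and i: "i \<in> {1..<k}" for xs i
  proof (rule ccontr)
    assume neq: "xs ! (i - 1) \<noteq> xs ! Suc i"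
    have xs': "xs \<in> kpaths G k k" and i': "1 \<le> i" "i < k" using c xs i by auto
    have mem: "delete_nth i xs \<in> kpaths G (k - 1) k"
      using neq delete_nth_in_kpaths_iff[OF G xs' i'] by simp
    have iff: "delete_nth j ys = delete_nth i xs \<longleftrightarrow> ys = xs \<and> j = i"
      if "ys \<in> Poly_Mapping.keys c" "j \<in> {1..<k}" for ys j
    proof
      assume "delete_nth j ys = delete_nth i xs"
      moreover have "ys \<in> kpaths G k k" "1 \<le> j" "j < k" using that c by auto
      ultimately show "ys = xs \<and> j = i"
        using delete_nth_cancel[OF G xs' i' _ _ _ _ mem] by metis
    qed simp
    have "0 = Poly_Mapping.lookup (MC_boundary G k k c) (delete_nth i xs)"
      by (simp add: c0)
    \<comment> \<open>By \<open>iff\<close> only the term of \<open>xs\<close> at position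
      \<open>i\<close> survives.\<close>
    also have "\<dots> = (\<Sum>ys\<in>Poly_Mapping.keys c. \<Sum>j\<in>{1..<k}.
        if j = i then if ys = xs then Poly_Mapping.lookup c xs * (-1) ^ i else 0 else 0)"
      unfolding lookup_MC_boundary using iff mem by (intro sum.cong refl) auto
    also have "\<dots> = Poly_Mapping.lookup c xs * (-1) ^ i"
      using xs i by simp
    finally show False using xs by (simp add: in_keys_iff)
  qed
  with c show "c \<in> carrier (free_Abelian_group (backtracking_walks G k))"
    by (auto simp: backtracking_walks_def)
next
  fix c assume c: "c \<in> carrier (free_Abelian_group (backtracking_walks G k))"
  have "Poly_Mapping.lookup (MC_boundary G k k c) ys = 0" for ys
    unfolding lookup_MC_boundary
  proof (intro sum.neutral ballI)
    fix xs i assume "xs \<in> Poly_Mapping.keys c" "i \<in> {1..<k}"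
    then have "delete_nth i xs \<notin> kpaths G (k - 1) k"
      using c delete_nth_in_kpaths_iff[OF G, of xs k i] by (auto simp: backtracking_walks_def)
    then show "(if delete_nth i xs = ys \<and> ys \<in> kpaths G (k - 1) k
      then Poly_Mapping.lookup c xs * (-1) ^ i else 0) = 0" by auto
  qed
  then have "MC_boundary G k k c = 0"
    by (intro poly_mapping_eqI) simp
  with c show "c \<in> MC_cycles G k k"
    by (auto simp: MC_cycles_def MC_def backtracking_walks_def)
qed

lemma MC_boundaries_diagonal: "MC_boundaries G k k = {0}"
proof -
  have "kpaths G (Suc k) k = {}"
    using kpaths_length_ge[of _ G "Suc k" k] by auto
  then have "carrier (MC G (Suc k) k) = {0}"
    by (auto simp: MC_def)
  then show ?thesis
    by (simp add: MC_boundaries_def MC_boundary_def)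
qed

text \<open>Free abelian groups on different sets share unit and operation as records, so equal
  carriers give an equality and not just an isomorphism.\<close>

lemma subgroup_generated_free_Abelian_group:
  assumes "X \<subseteq> Y"
  shows "subgroup_generated (free_Abelian_group Y) (carrier (free_Abelian_group X)) = free_Abelian_group X"
proof -
  have "subgroup (carrier (free_Abelian_group X)) (free_Abelian_group Y)"
    using assms keys_add by (intro group.subgroupI) (fastforce simp: exI[of _ 0])+
  then have "carrier (subgroup_generated (free_Abelian_group Y) (carrier (free_Abelian_group X)))
      = carrier (free_Abelian_group X)"
    by (rule subgroup.carrier_subgroup_generated_subgroup)
  then show ?thesis
    by (simp add: subgroup_generated_def free_Abelian_group_def)
qed

lemma MH_diagonal:
  assumes "simple_graph G" "no_short_cycles G"
  shows "MH G k k = free_Abelian_group (backtracking_walks G k) Mod {0}"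
  unfolding MH_def MC_boundaries_diagonal MC_cycles_diagonal[OF assms] MC_def
  by (subst subgroup_generated_free_Abelian_group) (auto simp: backtracking_walks_def)

section \<open>Counting backtracking walks\<close>

lemma card_darts:
  assumes "simple_graph G"
  shows "finite {(u, v). {u, v} \<in> edges G}" "card {(u, v). {u, v} \<in> edges G} = 2 * card (edges G)"
proof -
  have fin: "finite (edges G)"
    using assms by (auto simp: simple_graph_def intro: finite_subset[of _ "Pow (verts G)"])
  have two: "finite {(u, v). {u, v} = e} \<and> card {(u, v). {u, v} = e} = 2" if "e \<in> edges G" for e
  proof -
    have "card e = 2" using that assms by (simp add: simple_graph_def)
    then obtain a b where ab: "e = {a, b}" "a \<noteq> b" by (auto simp: card_2_iff)
    then have "{(u, v). {u, v} = e} = {(a, b), (b, a)}" by (auto simp: doubleton_eq_iff)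
    with ab show ?thesis by simp
  qed
  \<comment> \<open>Oriented edges are grouped by their underlying edge, two in each group.\<close>
  have eq: "{(u, v). {u, v} \<in> edges G} = (\<Union>e\<in>edges G. {(u, v). {u, v} = e})" by auto
  show "finite {(u, v). {u, v} \<in> edges G}"
    unfolding eq using fin two by blast
  show "card {(u, v). {u, v} \<in> edges G} = 2 * card (edges G)"
    unfolding eq using fin two by (subst card_UN_disjoint) auto
qed

lemma backtracking_walks_0: "backtracking_walks G 0 = (\<lambda>x. [x]) ` verts G"
  by (auto simp: backtracking_walks_def kpaths_def length_Suc_conv zero_enat_def)

text \<open>Turning back at every interior vertex makes the walk alternate between its first two
  entries, which form an oriented edge; \<open>k > 0\<close> provides the second entry.\<close>

lemma bij_betw_darts_backtracking_walks:
  assumes G: "simple_graph G" and k: "k > 0"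
  shows "bij_betw (\<lambda>(u, v). map (\<lambda>i. if even i then u else v) [0..<Suc k])
    {(u, v). {u, v} \<in> edges G} (backtracking_walks G k)"
proof (rule bij_betw_byWitness[where f' = "\<lambda>xs. (xs ! 0, xs ! 1)"]; (intro ballI subsetI)?)
  fix d assume "d \<in> {(u, v). {u, v} \<in> edges G}"
  with k show "(\<lambda>xs. (xs ! 0, xs ! 1)) ((\<lambda>(u, v). map (\<lambda>i. if even i then u else v) [0..<Suc k]) d) = d"
    by (auto simp del: upt_Suc)
next
  fix xs assume xs: "xs \<in> backtracking_walks G k"
  then have len: "length xs = Suc k" by (simp add: backtracking_walks_def kpaths_def)
  \<comment> \<open>Induction in steps of two: turning back at \<open>Suc j\<close> equates the
    entries \<open>j\<close> and \<open>j + 2\<close>.\<close>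
  have alt: "xs ! i = (if even i then xs ! 0 else xs ! 1)" if "i < Suc k" for i
    using that
  proof (induction i rule: induct_nat_012)
    case (ge2 j)
    moreover have "Suc j \<in> {1..<k}" using ge2.prems by simp
    then have "xs ! (Suc j - 1) = xs ! Suc (Suc j)"
      using xs unfolding backtracking_walks_def by blast
    ultimately show ?case by simp
  qed simp_all
  have "map (\<lambda>i. if even i then xs ! 0 else xs ! 1) [0..<Suc k] = xs"
  proof (rule nth_equalityI)
    fix i assume "i < length (map (\<lambda>i. if even i then xs ! 0 else xs ! 1) [0..<Suc k])"
    then show "map (\<lambda>i. if even i then xs ! 0 else xs ! 1) [0..<Suc k] ! i = xs ! i"
      using alt[of i] by (simp del: upt_Suc)
  qed (simp add: len)
  then show "(\<lambda>(u, v). map (\<lambda>i. if even i then u else v) [0..<Suc k]) ((\<lambda>xs. (xs ! 0, xs ! 1)) xs) = xs"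
    by (simp only: prod.case)
next
  fix xs assume "xs \<in> (\<lambda>(u, v). map (\<lambda>i. if even i then u else v) [0..<Suc k]) ` {(u, v). {u, v} \<in> edges G}"
  then obtain u v where uv: "{u, v} \<in> edges G" and xs: "xs = map (\<lambda>i. if even i then u else v) [0..<Suc k]"
    by auto
  have nth: "xs ! i = (if even i then u else v)" if "i < Suc k" for i
    using that by (simp add: xs del: upt_Suc)
  have "set xs \<subseteq> verts G"
    using simple_graph_edge[OF G uv] by (auto simp: xs)
  moreover have "{xs ! i, xs ! Suc i} \<in> edges G" if "i < k" for i
    using that uv by (simp add: nth insert_commute)
  moreover have "length xs = Suc k" by (simp add: xs)
  ultimately show "xs \<in> backtracking_walks G k"
    by (auto simp: backtracking_walks_def kpaths_diagonal[OF G] nth)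
next
  fix d assume "d \<in> (\<lambda>xs. (xs ! 0, xs ! 1)) ` backtracking_walks G k"
  with k show "d \<in> {(u, v). {u, v} \<in> edges G}"
    using kpaths_diagonal_edge[of _ G k 0] by (auto simp: backtracking_walks_def)
qed

lemma finite_card_backtracking_walks:
  assumes "simple_graph G"
  shows "finite (backtracking_walks G k)"
    and "card (backtracking_walks G 0) = card (verts G)"
    and "k > 0 \<Longrightarrow> card (backtracking_walks G k) = 2 * card (edges G)"
proof -
  have inj: "inj_on (\<lambda>x. [x]) (verts G)" by (simp add: inj_on_def)
  show "card (backtracking_walks G 0) = card (verts G)"
    unfolding backtracking_walks_0 by (rule card_image[OF inj])
  show "card (backtracking_walks G k) = 2 * card (edges G)" if "k > 0"
    using bij_betw_same_card[OF bij_betw_darts_backtracking_walks[OF assms that]] card_darts(2)[OF assms]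
    by simp
  show "finite (backtracking_walks G k)"
  proof (cases "k = 0")
    case True
    with assms show ?thesis by (simp add: backtracking_walks_0 simple_graph_def)
  next
    case False
    then show ?thesis
      using bij_betw_finite[OF bij_betw_darts_backtracking_walks[OF assms]] card_darts(1)[OF assms] by simp
  qed
qed

theorem theorem4p5:
  fixes G :: "'a ugraph" and Hs :: "'a ugraph list"
  assumes "outerplanar_decomposition G Hs"
    and "\<forall>H\<in>set Hs. is_K2 H \<or> (\<exists>n. even n \<and> n \<noteq> 4 \<and> is_cycle_graph n H)"
  shows "(\<forall>k. torsion_free (MH G k k)) \<and>
         ab_rank (MH G 0 0) = enat (card (verts G)) \<and>
         (\<forall>k>0. ab_rank (MH G k k) = enat (2 * card (edges G)))"
proof -
  have G: "simple_graph G" "no_short_cycles G"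
    using assms outerplanar_decomposition_simple_graph no_short_cycles_outerplanar by blast+
  have MH: "torsion_free (MH G k k) \<and> ab_rank (MH G k k) = enat (card (backtracking_walks G k))" for k
  proof -
    let ?F = "free_Abelian_group (backtracking_walks G k)"
    interpret F: comm_group ?F by (rule abelian_free_Abelian_group)
    \<comment> \<open>Cosets of the trivial subgroup are singletons, and \<open>the_elem\<close>
      extracts their element.\<close>
    have "the_elem \<in> iso (MH G k k) ?F"
      using F.trivial_factor_iso unfolding MH_diagonal[OF G] by simp
    moreover have "group (MH G k k)"
      using F.one_is_normal normal.factorgroup_is_group[of "{0}" ?F] by (simp add: MH_diagonal[OF G])
    ultimately show ?thesis
      using torsion_free_and_rank_if_iso_free finite_card_backtracking_walks(1)[OF G(1)] by blast
  qed
  then show ?thesis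
    by (simp add: finite_card_backtracking_walks(2,3)[OF G(1)])
qed

end
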